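(* Let $n_0\ge1$ and $j_{\max}\ge1$ be integers and $n=2^{j_{\max}}n_0$. For every $x\in\mathcal{X}$, the multi-level Monte Carlo estimator $\widehat{\mathcal{M}}[\nabla\mathcal{L}]$ with these parameters satisfies $$\mathbb{E}\,\widehat{\mathcal{M}}[\nabla\mathcal{L}]=\mathbb{E}\,\nabla\mathcal{L}(x;S_1^n)=\nabla\overline{\mathcal{L}}(x;n),$$ where $S_1,\dots,S_n$ are i.i.d. from $P_0$, and the expected sample size it uses is $\mathbb{E}\,[2^Jn_0]=n_0(1+\log_2(n/n_0))$.
   Context: Setting: $\mathcal{X}\subset\mathbb{R}^d$ is closed, convex and bounded; $P_0$ is a distribution on $\mathbb{S}$; $\ell:\mathcal{X}\times\mathbb{S}\to[0,B]$ is convex and $G$-Lipschitz in $x$, with $\nabla\ell(x;s)$ a subgradient in $x$. For closed convex $\phi,\psi:\mathbb{R}_+\to\mathbb{R}\cup\{\infty\}$ with $\phi(1)=\psi(1)=0$ and $\rho,\lambda\ge0$, the robust objective on a sample is $$\mathcal{L}(x;s_1^k)=\sup\Big\{\sum_{i\le k}q_i\ell(x;s_i)-\frac{\lambda}{k}\sum_{i\le k}\psi(kq_i)\ :\ q\in\Delta^k,\ \frac1k\sum_{i\le k}\phi(kq_i)\le\rho\Big\},$$ and $\nabla\mathcal{L}(x;s_1^k)=\sum_iq_i^\star\nabla\ell(x;s_i)$ for a (measurably chosen) maximizer $q^\star$. The surrogate is $\overline{\mathcal{L}}(x;n)=\mathbb{E}\,\mathcal{L}(x;S_1^n)$, and $\nabla\overline{\mathcal{L}}(x;n)$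 denotes its subgradient $\mathbb{E}\,\nabla\mathcal{L}(x;S_1^n)$. MLMC estimator: let $J$ take values in $\{1,\dots,j_{\max}\}$ with $q(j)=\mathbb{P}(J=j)=2^{-j}$ for $j<j_{\max}$ and $q(j_{\max})=2^{-j_{\max}+1}$. Given $J$, draw $S_1,\dots,S_{2^Jn_0}$ i.i.d. from $P_0$. For even $k$ let $$\widehat{\mathcal{D}}_k=\nabla\mathcal{L}(x;S_1^k)-\tfrac12\big(\nabla\mathcal{L}(x;S_1^{k/2})+\nabla\mathcal{L}(x;S_{k/2+1}^k)\big),$$ and set $\widehat{\mathcal{M}}[\nabla\mathcal{L}]=\nabla\mathcal{L}(x;S_1^{n_0})+\frac{1}{q(J)}\widehat{\mathcal{D}}_{2^Jn_0}$. *)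

theory Defs
  imports "HOL-Probability.Probability"
begin

definition is_subgradient_on ::
  "'a::real_inner set \<Rightarrow> ('a \<Rightarrow> real) \<Rightarrow> 'a \<Rightarrow> 'a \<Rightarrow> bool"
where
  "is_subgradient_on X f x g \<longleftrightarrow> (\<forall>y\<in>X. f x + g \<bullet> (y - x) \<le> f y)"

text \<open>
  A function from the nonnegative reals to the reals extended by plus infinity is closed convex
  when its epigraph is a closed convex subset of the plane. Values at negative arguments are
  irrelevant.
\<close>

definition closed_convex_fun :: "(real \<Rightarrow> ereal) \<Rightarrow> bool"
where
  "closed_convex_fun f \<longleftrightarrow>
     (\<forall>t\<ge>0. f t \<noteq> - \<infinity>) \<and>
     convex {(t, r :: real). 0 \<le> t \<and> f t \<le> ereal r} \<and>
     closed {(t, r :: real). 0 \<le> t \<and> f t \<le> ereal r}"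

text \<open>
  Samples and weight vectors of size \<open>k\<close> are functions on the index set \<open>{..<k}\<close>, so the sample
  point $S_{i+1}$ is \<open>s i\<close>. Samples of size \<open>k\<close> are kept extensional, as elements of
  \<open>space (PiM {..<k} (\<lambda>_. P0))\<close>, so that anything depending on a sample depends on its
  first \<open>k\<close> entries only.
\<close>

definition weight_simplex :: "nat \<Rightarrow> (nat \<Rightarrow> real) set"
where
  "weight_simplex k = {q. (\<forall>i<k. 0 \<le> q i) \<and> (\<Sum>i<k. q i) = 1}"

definition feasible_weights :: "(real \<Rightarrow> ereal) \<Rightarrow> real \<Rightarrow> nat \<Rightarrow> (nat \<Rightarrow> real) set"
where
  "feasible_weights \<phi> \<rho> k =
     {q \<in> weight_simplex k. ereal (1 / real k) * (\<Sum>i<k. \<phi> (real k * q i)) \<le> ereal \<rho>}"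

text \<open>For \<open>\<lambda> = 0\<close> the penalty vanishes even where \<open>\<psi>\<close> is infinite, since \<open>0 * \<infinity> = 0\<close> in \<open>ereal\<close>.\<close>

definition weighted_objective ::
  "('a \<Rightarrow> 's \<Rightarrow> real) \<Rightarrow> (real \<Rightarrow> ereal) \<Rightarrow> real \<Rightarrow> nat \<Rightarrow> 'a \<Rightarrow> (nat \<Rightarrow> 's) \<Rightarrow> (nat \<Rightarrow> real) \<Rightarrow> ereal"
where
  "weighted_objective l \<psi> lam k x s q =
     ereal (\<Sum>i<k. q i * l x (s i)) - ereal (lam / real k) * (\<Sum>i<k. \<psi> (real k * q i))"

definition robust_loss ::
  "('a \<Rightarrow> 's \<Rightarrow> real) \<Rightarrow> (real \<Rightarrow> ereal) \<Rightarrow> (real \<Rightarrow> ereal) \<Rightarrow> real \<Rightarrow> real \<Rightarrow>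
     nat \<Rightarrow> 'a \<Rightarrow> (nat \<Rightarrow> 's) \<Rightarrow> ereal"
where
  "robust_loss l \<phi> \<psi> \<rho> lam k x s =
     (SUP q\<in>feasible_weights \<phi> \<rho> k. weighted_objective l \<psi> lam k x s q)"

definition measurable_maximizer ::
  "'a set \<Rightarrow> 's measure \<Rightarrow> ('a \<Rightarrow> 's \<Rightarrow> real) \<Rightarrow> (real \<Rightarrow> ereal) \<Rightarrow> (real \<Rightarrow> ereal) \<Rightarrow>
     real \<Rightarrow> real \<Rightarrow> (nat \<Rightarrow> 'a \<Rightarrow> (nat \<Rightarrow> 's) \<Rightarrow> nat \<Rightarrow> real) \<Rightarrow> bool"
where
  "measurable_maximizer X P0 l \<phi> \<psi> \<rho> lam qs \<longleftrightarrow>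
     (\<forall>k\<ge>1. \<forall>x\<in>X.
        (\<forall>s\<in>space (PiM {..<k} (\<lambda>_. P0)).
           qs k x s \<in> feasible_weights \<phi> \<rho> k \<and>
           weighted_objective l \<psi> lam k x s (qs k x s) = robust_loss l \<phi> \<psi> \<rho> lam k x s) \<and>
        (\<forall>i<k. (\<lambda>s. qs k x s i) \<in> borel_measurable (PiM {..<k} (\<lambda>_. P0))))"

definition robust_grad ::
  "('a \<Rightarrow> 's \<Rightarrow> 'a::real_vector) \<Rightarrow> (nat \<Rightarrow> 'a \<Rightarrow> (nat \<Rightarrow> 's) \<Rightarrow> nat \<Rightarrow> real) \<Rightarrow>
     nat \<Rightarrow> 'a \<Rightarrow> (nat \<Rightarrow> 's) \<Rightarrow> 'a"
where
  "robust_grad gl qs k x s = (\<Sum>i<k. qs k x s i *\<^sub>R gl x (s i))"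

definition surrogate ::
  "'s measure \<Rightarrow> ('a \<Rightarrow> 's \<Rightarrow> real) \<Rightarrow> (real \<Rightarrow> ereal) \<Rightarrow> (real \<Rightarrow> ereal) \<Rightarrow> real \<Rightarrow> real \<Rightarrow>
     nat \<Rightarrow> 'a \<Rightarrow> real"
where
  "surrogate P0 l \<phi> \<psi> \<rho> lam n x =
     (\<integral>s. real_of_ereal (robust_loss l \<phi> \<psi> \<rho> lam n x s) \<partial>PiM {..<n} (\<lambda>_. P0))"

definition surrogate_grad ::
  "'s measure \<Rightarrow> ('a \<Rightarrow> 's \<Rightarrow> 'a::{banach, second_countable_topology}) \<Rightarrow>
     (nat \<Rightarrow> 'a \<Rightarrow> (nat \<Rightarrow> 's) \<Rightarrow> nat \<Rightarrow> real) \<Rightarrow> nat \<Rightarrow> 'a \<Rightarrow> 'a"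
where
  "surrogate_grad P0 gl qs n x = (\<integral>s. robust_grad gl qs n x s \<partial>PiM {..<n} (\<lambda>_. P0))"

definition iid_sample :: "'w measure \<Rightarrow> 's measure \<Rightarrow> nat \<Rightarrow> (nat \<Rightarrow> 'w \<Rightarrow> 's) \<Rightarrow> bool"
where
  "iid_sample M P0 k T \<longleftrightarrow>
     prob_space.indep_vars M (\<lambda>_. P0) T {..<k} \<and> (\<forall>i<k. distr M P0 (T i) = P0)"

text \<open>The subsample of \<open>k\<close> consecutive points $S_{a+1}, \dots, S_{a+k}$, re-indexed from \<open>0\<close>.\<close>

definition block :: "(nat \<Rightarrow> 's) \<Rightarrow> nat \<Rightarrow> nat \<Rightarrow> nat \<Rightarrow> 's"
where
  "block s a k = (\<lambda>i\<in>{..<k}. s (a + i))"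

definition level_prob :: "nat \<Rightarrow> nat \<Rightarrow> real"
where
  "level_prob jmax j = (if j < jmax then 2 powi (- int j) else 2 powi (- int jmax + 1))"

definition level_difference ::
  "('a \<Rightarrow> 's \<Rightarrow> 'a::real_vector) \<Rightarrow> (nat \<Rightarrow> 'a \<Rightarrow> (nat \<Rightarrow> 's) \<Rightarrow> nat \<Rightarrow> real) \<Rightarrow>
     nat \<Rightarrow> 'a \<Rightarrow> (nat \<Rightarrow> 's) \<Rightarrow> 'a"
where
  "level_difference gl qs k x s =
     robust_grad gl qs k x (block s 0 k)
     - (1/2) *\<^sub>R (robust_grad gl qs (k div 2) x (block s 0 (k div 2))
               + robust_grad gl qs (k div 2) x (block s (k div 2) (k div 2)))"

definition mlmc_estimator ::
  "('a \<Rightarrow> 's \<Rightarrow> 'a::real_vector) \<Rightarrow> (nat \<Rightarrow> 'a \<Rightarrow> (nat \<Rightarrow> 's) \<Rightarrow> nat \<Rightarrow> real) \<Rightarrow>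
     nat \<Rightarrow> nat \<Rightarrow> 'a \<Rightarrow> nat \<Rightarrow> (nat \<Rightarrow> 's) \<Rightarrow> 'a"
where
  "mlmc_estimator gl qs n0 jmax x j s =
     robust_grad gl qs n0 x (block s 0 n0)
     + (1 / level_prob jmax j) *\<^sub>R level_difference gl qs (2 ^ j * n0) x s"

end

theory Submission
  imports Defs
begin

text \<open>
  Write $g(k) = \mathbb{E}\, \nabla\mathcal{L}(x; S_1^k)$. Given $J = j$, the sample is i.i.d., so
  each of the four blocks in the estimator is itself an i.i.d. sample of its length
  (\<open>expectation_block\<close>), and the two halves of the long block have the same expectation. The level
  difference therefore has conditional mean $g(2^j n_0) - g(2^{j-1} n_0)$. Dividing by the
  probability of level $j$ cancels the weight which this level receives when one averages over $J$
  (\<open>total_expectation\<close>), so the mean of the estimator is the telescoping sum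
  $g(n_0) + \sum_j (g(2^j n_0) - g(2^{j-1} n_0)) = g(n)$. All expectations exist because the
  maximizing weights lie in $[0,1]$ and the subgradients of the loss are integrable. The expected
  sample size is a sum of $j_{\max} - 1$ terms equal to $n_0$ and a last one equal to $2 n_0$.

  That $g(n)$ is a subgradient of the surrogate follows sample by sample: the weights that are
  optimal at $x$ remain feasible at $y$, so
  $\mathcal{L}(y) - \mathcal{L}(x) \ge \sum_i q_i^\star (\ell(y; s_i) - \ell(x; s_i))$, and the
  subgradient inequality of $\ell$ applies to every summand (\<open>robust_loss_subgradient\<close>).
  Integrating this inequality needs the robust loss to be an integrable real function of the
  sample. It lies in $[0,B]$: the uniform weights pay no penalty, and every penalty is nonnegative
  by Jensen's inequality (\<open>divergence_nonneg\<close>). It is measurable since it is attained at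
  measurable weights and \<open>\<psi>\<close>, being lower semicontinuous, is a Borel function.
\<close>

section \<open>Laws of blocks and conditioning on the level\<close>

text \<open>
  The first $K$ observations have the product law $P_0^K$, and selecting and re-indexing distinct
  coordinates of a product of probability measures gives the product over the selected ones.
\<close>

lemma block_of_iid_sample:
  assumes M: "prob_space M" and P0: "prob_space P0"
    and iid: "iid_sample M P0 K T" and ak: "a + k \<le> K" and K: "0 < K"
  shows "(\<lambda>\<omega>. block (\<lambda>i. T i \<omega>) a k) \<in> measurable M (PiM {..<k} (\<lambda>_. P0))"
    and "distr M (PiM {..<k} (\<lambda>_. P0)) (\<lambda>\<omega>. block (\<lambda>i. T i \<omega>) a k) = PiM {..<k} (\<lambda>_. P0)"
proof -
  interpret M: prob_space M by (rule M)
  have ind: "M.indep_vars (\<lambda>_. P0) T {..<K}" and law: "\<And>i. i < K \<Longrightarrow> distr M P0 (T i) = P0"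
    using iid by (auto simp: iid_sample_def)
  have T: "\<And>i. i < K \<Longrightarrow> T i \<in> measurable M P0"
    using ind by (auto simp: M.indep_vars_def)
  define F where "F = (\<lambda>\<omega>. \<lambda>i\<in>{..<K}. T i \<omega>)"
  define R where "R = (\<lambda>s :: nat \<Rightarrow> 'b. \<lambda>i\<in>{..<k}. s (a + i))"
  have F: "F \<in> measurable M (PiM {..<K} (\<lambda>_. P0))"
    unfolding F_def using T by (intro measurable_restrict) auto
  have R: "R \<in> measurable (PiM {..<K} (\<lambda>_. P0)) (PiM {..<k} (\<lambda>_. P0))"
    unfolding R_def using ak by (intro measurable_restrict measurable_component_singleton) auto
  have RF: "(\<lambda>\<omega>. block (\<lambda>i. T i \<omega>) a k) = R \<circ> F"
    using ak by (auto simp: fun_eq_iff block_def R_def F_def restrict_def)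
  show "(\<lambda>\<omega>. block (\<lambda>i. T i \<omega>) a k) \<in> measurable M (PiM {..<k} (\<lambda>_. P0))"
    unfolding RF using F R by (rule measurable_comp)
  have "distr M (PiM {..<K} (\<lambda>_. P0)) F = PiM {..<K} (\<lambda>i. distr M P0 (T i))"
    unfolding F_def using ind K T
    by (subst (asm) M.indep_vars_iff_distr_eq_PiM') auto
  also have "\<dots> = PiM {..<K} (\<lambda>_. P0)"
    by (intro PiM_cong) (auto simp: law)
  finally have lawF: "distr M (PiM {..<K} (\<lambda>_. P0)) F = PiM {..<K} (\<lambda>_. P0)" .
  have "distr M (PiM {..<k} (\<lambda>_. P0)) (R \<circ> F)
      = distr (distr M (PiM {..<K} (\<lambda>_. P0)) F) (PiM {..<k} (\<lambda>_. P0)) R"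
    using F R by (simp add: distr_distr)
  also have "\<dots> = PiM {..<k} (\<lambda>_. P0)"
    unfolding lawF R_def
    using distr_PiM_reindex[of "{..<K}" "\<lambda>_. P0" "\<lambda>i. a + i" "{..<k}"] P0 ak
    by (auto simp: inj_on_def Pi_def)
  finally show "distr M (PiM {..<k} (\<lambda>_. P0)) (\<lambda>\<omega>. block (\<lambda>i. T i \<omega>) a k) = PiM {..<k} (\<lambda>_. P0)"
    unfolding RF .
qed

lemma expectation_block:
  fixes h :: "(nat \<Rightarrow> 's) \<Rightarrow> 'b :: {banach, second_countable_topology}"
  assumes "prob_space M" "prob_space P0" "iid_sample M P0 K T" "a + k \<le> K" "0 < K"
    and h: "integrable (PiM {..<k} (\<lambda>_. P0)) h"
  shows "has_bochner_integral M (\<lambda>\<omega>. h (block (\<lambda>i. T i \<omega>) a k)) (\<integral>s. h s \<partial>PiM {..<k} (\<lambda>_. P0))"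
proof -
  note b = block_of_iid_sample[OF assms(1-5)]
  have hm: "h \<in> borel_measurable (PiM {..<k} (\<lambda>_. P0))" using h by auto
  show ?thesis
    unfolding has_bochner_integral_iff
    using integrable_distr_eq[OF b(1) hm] integral_distr[OF b(1) hm] h by (simp add: b(2))
qed

text \<open>
  Conditioning on an event is taking the density \<open>indicator A / measure M A\<close>.
\<close>

lemma has_bochner_integral_uniform_measure:
  fixes f :: "'a \<Rightarrow> 'b :: {banach, second_countable_topology}"
  assumes A: "A \<in> sets M" "0 < measure M A"
    and f: "has_bochner_integral (uniform_measure M A) f c"
  shows "has_bochner_integral M (\<lambda>\<omega>. indicator A \<omega> *\<^sub>R f \<omega>) (measure M A *\<^sub>R c)"
proof -
  have fin: "emeasure M A \<noteq> \<infinity>" using A(2) by (auto simp: measure_def)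
  have U: "uniform_measure M A = density M (\<lambda>\<omega>. ennreal (indicator A \<omega> / measure M A))"
    unfolding uniform_measure_def
    using A fin
    by (intro density_cong)
       (auto split: split_indicator simp: emeasure_eq_ennreal_measure divide_ennreal
             simp flip: ennreal_1)
  have fm: "f \<in> borel_measurable M"
    using f by (auto simp: has_bochner_integral_iff dest!: borel_measurable_integrable)
  have g: "(\<lambda>\<omega>. indicator A \<omega> / measure M A) \<in> borel_measurable M" using A(1) by simp
  have g0: "AE \<omega> in M. (0::real) \<le> indicator A \<omega> / measure M A" by simp
  have "has_bochner_integral M (\<lambda>\<omega>. (indicator A \<omega> / measure M A) *\<^sub>R f \<omega>) c"
    using f integrable_density[OF fm g g0] integral_density[OF fm g g0]
    unfolding has_bochner_integral_iff U by simp
  from has_bochner_integral_scaleR_right[OF this, of "measure M A"]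
  show ?thesis using A(2) by simp
qed

text \<open>
  The means are conditional ones because the law of the sample is prescribed only given the level:
  its size depends on $J$.
\<close>

lemma total_expectation:
  fixes F :: "'j \<Rightarrow> 'a \<Rightarrow> 'b :: {banach, second_countable_topology}"
  assumes J: "J \<in> measurable M (count_space I)" and I: "finite I"
    and pos: "\<And>j. j \<in> I \<Longrightarrow> 0 < measure M {\<omega> \<in> space M. J \<omega> = j}"
    and F: "\<And>j. j \<in> I \<Longrightarrow>
      has_bochner_integral (uniform_measure M {\<omega> \<in> space M. J \<omega> = j}) (F j) (c j)"
  shows "has_bochner_integral M (\<lambda>\<omega>. F (J \<omega>) \<omega>)
    (\<Sum>j\<in>I. measure M {\<omega> \<in> space M. J \<omega> = j} *\<^sub>R c j)"
proof -
  define A where "A j = {\<omega> \<in> space M. J \<omega> = j}" for j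
  have A: "A j \<in> sets M" if "j \<in> I" for j
  proof -
    have "A j = J -` {j} \<inter> space M" by (auto simp: A_def)
    then show ?thesis using measurable_sets[OF J, of "{j}"] that by simp
  qed
  have "has_bochner_integral M (\<lambda>\<omega>. \<Sum>j\<in>I. indicator (A j) \<omega> *\<^sub>R F j \<omega>)
      (\<Sum>j\<in>I. measure M (A j) *\<^sub>R c j)"
    using A pos F
    by (intro has_bochner_integral_sum has_bochner_integral_uniform_measure) (auto simp: A_def)
  moreover have "(\<Sum>j\<in>I. indicator (A j) \<omega> *\<^sub>R F j \<omega>) = F (J \<omega>) \<omega>" if "\<omega> \<in> space M" for \<omega>
  proof -
    have "J \<omega> \<in> I" using J that by (auto dest: measurable_space)
    moreover have "(\<Sum>j\<in>I. indicator (A j) \<omega> *\<^sub>R F j \<omega>) = (\<Sum>j\<in>I. if J \<omega> = j then F j \<omega> else 0)"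
      using that by (intro sum.cong) (auto simp: A_def)
    ultimately show ?thesis using I by simp
  qed
  ultimately show ?thesis
    unfolding A_def by (subst has_bochner_integral_cong[OF refl _ refl]) auto
qed

section \<open>The robust loss on a sample\<close>

text \<open>
  \<open>\<psi>\<close> may be negative away from $1$, but the average of the points $k q_i$ is $1$, so by
  Jensen's inequality the average of their values is at least $\psi(1) = 0$. The inequality is
  obtained from the convex epigraph: the average of the points $(k q_i, \psi(k q_i))$ lies in it.
\<close>

lemma divergence_nonneg:
  assumes \<psi>: "closed_convex_fun \<psi>" "\<psi> 1 = 0" and q: "q \<in> weight_simplex k" and k: "0 < k"
  shows "0 \<le> (\<Sum>i<k. \<psi> (real k * q i))"
proof (cases "\<exists>i<k. \<psi> (real k * q i) = \<infinity>")
  case True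
  then have "(\<Sum>i<k. \<psi> (real k * q i)) = \<infinity>" by (auto simp: sum_Pinfty)
  then show ?thesis by simp
next
  case False
  have q0: "\<And>i. i < k \<Longrightarrow> 0 \<le> q i" and q1: "(\<Sum>i<k. q i) = 1"
    using q by (auto simp: weight_simplex_def)
  define r where "r i = real_of_ereal (\<psi> (real k * q i))" for i
  have r: "\<psi> (real k * q i) = ereal (r i)" if "i < k" for i
    using False that q0[OF that] \<psi>(1) by (auto simp: r_def closed_convex_fun_def ereal_real)
  have "(\<Sum>i<k. (1 / real k) *\<^sub>R (real k * q i, r i)) \<in> {(t, r :: real). 0 \<le> t \<and> \<psi> t \<le> ereal r}"
    using \<psi>(1) k q0 r by (intro convex_sum) (auto simp: closed_convex_fun_def)
  moreover have "(\<Sum>i<k. (1 / real k) *\<^sub>R (real k * q i, r i)) = (1, (\<Sum>i<k. r i) / real k)"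
    using k q1 by (simp add: sum_prod sum_divide_distrib)
  ultimately have "0 \<le> (\<Sum>i<k. r i) / real k" using \<psi>(2) by simp
  then have "0 \<le> (\<Sum>i<k. r i)" using k by (simp add: zero_le_divide_iff)
  moreover have "(\<Sum>i<k. \<psi> (real k * q i)) = ereal (\<Sum>i<k. r i)"
    using r by (simp flip: sum_ereal)
  ultimately show ?thesis by simp
qed

lemma uniform_weights_feasible:
  assumes "0 < k" "\<phi> 1 = 0" "0 \<le> \<rho>"
  shows "(\<lambda>_. 1 / real k) \<in> feasible_weights \<phi> \<rho> k"
  using assms by (simp add: feasible_weights_def weight_simplex_def)

text \<open>
  The uniform weights are feasible and free of penalty because $\phi(1) = \psi(1) = 0$, which gives
  the lower bound. Above, the penalty only lowers a weighted mean of losses that are at most $B$.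
\<close>

lemma robust_loss_bounds:
  assumes k: "0 < k" and \<phi>: "\<phi> 1 = 0" and \<psi>: "closed_convex_fun \<psi>" "\<psi> 1 = 0"
    and nonneg: "0 \<le> \<rho>" "0 \<le> lam" and l: "\<And>i. i < k \<Longrightarrow> l x (s i) \<in> {0..B}"
  shows "0 \<le> robust_loss l \<phi> \<psi> \<rho> lam k x s" "robust_loss l \<phi> \<psi> \<rho> lam k x s \<le> ereal B"
proof -
  have "weighted_objective l \<psi> lam k x s (\<lambda>_. 1 / real k) = ereal (\<Sum>i<k. (1 / real k) * l x (s i))"
    using k \<psi>(2) by (simp add: weighted_objective_def zero_ereal_def)
  then have "0 \<le> weighted_objective l \<psi> lam k x s (\<lambda>_. 1 / real k)"
    using l by (auto intro!: sum_nonneg)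
  then show "0 \<le> robust_loss l \<phi> \<psi> \<rho> lam k x s"
    unfolding robust_loss_def using uniform_weights_feasible[where \<phi> = \<phi>, OF k \<phi> nonneg(1)]
    by (rule SUP_upper2[rotated])
  show "robust_loss l \<phi> \<psi> \<rho> lam k x s \<le> ereal B"
    unfolding robust_loss_def
  proof (rule SUP_least)
    fix q assume "q \<in> feasible_weights \<phi> \<rho> k"
    then have q: "q \<in> weight_simplex k" by (simp add: feasible_weights_def)
    have "(\<Sum>i<k. q i * l x (s i)) \<le> (\<Sum>i<k. q i * B)"
      using q l by (intro sum_mono mult_left_mono) (auto simp: weight_simplex_def)
    also have "\<dots> = B" using q by (simp add: weight_simplex_def flip: sum_distrib_right)
    finally have "(\<Sum>i<k. q i * l x (s i)) \<le> B" .
    moreover have "0 \<le> ereal (lam / real k) * (\<Sum>i<k. \<psi> (real k * q i))"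
      using divergence_nonneg[OF \<psi> q k] nonneg by simp
    ultimately show "weighted_objective l \<psi> lam k x s q \<le> ereal B"
      unfolding weighted_objective_def
      by (metis diff_zero ereal_diff_le_self ereal_less_eq(3) order_trans)
  qed
qed

text \<open>
  A supremum of functions inherits at $x$ the subgradient of any function that attains it there.
  Here that function is the objective at the weights optimal for $x$; its penalty does not depend
  on the decision and cancels, once it is known to be finite.
\<close>

lemma robust_loss_subgradient:
  assumes k: "0 < k" and \<phi>: "\<phi> 1 = 0" and \<psi>: "closed_convex_fun \<psi>" "\<psi> 1 = 0"
    and nonneg: "0 \<le> \<rho>" "0 \<le> lam"
    and l: "\<And>i z. z \<in> X \<Longrightarrow> i < k \<Longrightarrow> l z (s i) \<in> {0..B}"
    and sub: "\<And>i. i < k \<Longrightarrow> is_subgradient_on X (\<lambda>z. l z (s i)) x (gl x (s i))"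
    and q: "qs k x s \<in> feasible_weights \<phi> \<rho> k"
      "weighted_objective l \<psi> lam k x s (qs k x s) = robust_loss l \<phi> \<psi> \<rho> lam k x s"
    and x: "x \<in> X"
  shows "is_subgradient_on X (\<lambda>z. real_of_ereal (robust_loss l \<phi> \<psi> \<rho> lam k z s)) x
    (robust_grad gl qs k x s)"
  unfolding is_subgradient_on_def
proof
  fix y assume y: "y \<in> X"
  define p where "p = qs k x s"
  define c where "c = ereal (lam / real k) * (\<Sum>i<k. \<psi> (real k * p i))"
  define L where "L z = robust_loss l \<phi> \<psi> \<rho> lam k z s" for z
  define r where "r z = real_of_ereal (L z)" for z
  have L: "L z = ereal (r z)" if "z \<in> X" for z
  proof -
    have "0 \<le> L z" "L z \<le> ereal B"
      unfolding L_def by (rule robust_loss_bounds[where l = l and \<phi> = \<phi> and x = z and s = s, OF k \<phi> \<psi> nonneg l[OF that]]; assumption)+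
    then show ?thesis by (cases "L z") (auto simp: r_def)
  qed
  have obj: "weighted_objective l \<psi> lam k z s p = ereal (\<Sum>i<k. p i * l z (s i)) - c" for z
    by (simp add: weighted_objective_def c_def)
  have eqx: "ereal (\<Sum>i<k. p i * l x (s i)) - c = ereal (r x)"
    using q(2) L[OF x] obj by (simp add: p_def L_def)
  \<comment> \<open>An infinite penalty would contradict that the optimal value is real.\<close>
  then obtain c' where c': "c = ereal c'" by (cases c) auto
  have "weighted_objective l \<psi> lam k y s p \<le> L y"
    unfolding L_def robust_loss_def using q(1) by (auto simp: p_def intro: SUP_upper)
  then have ley: "(\<Sum>i<k. p i * l y (s i)) - c' \<le> r y"
    unfolding obj L[OF y] c' by simp
  have "robust_grad gl qs k x s \<bullet> (y - x) = (\<Sum>i<k. p i * (gl x (s i) \<bullet> (y - x)))"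
    by (simp add: robust_grad_def p_def inner_sum_left)
  also have "\<dots> \<le> (\<Sum>i<k. p i * (l y (s i) - l x (s i)))"
    using sub y q(1)
    by (intro sum_mono mult_left_mono)
       (auto simp: is_subgradient_on_def p_def feasible_weights_def weight_simplex_def
             simp: le_diff_eq add.commute)
  also have "\<dots> = (\<Sum>i<k. p i * l y (s i)) - (\<Sum>i<k. p i * l x (s i))"
    by (simp add: right_diff_distrib sum_subtractf)
  finally show "real_of_ereal (robust_loss l \<phi> \<psi> \<rho> lam k x s) + robust_grad gl qs k x s \<bullet> (y - x)
      \<le> real_of_ereal (robust_loss l \<phi> \<psi> \<rho> lam k y s)"
    using ley eqx unfolding c' L_def[symmetric] r_def[symmetric] by simp
qed

section \<open>Measurability and integrability\<close>

text \<open>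
  A closed epigraph means closed sublevel sets. The values at negative arguments are
  arbitrary, so they are overwritten.
\<close>

lemma borel_measurable_closed_convex_fun:
  assumes "closed_convex_fun \<psi>"
  shows "(\<lambda>t. if 0 \<le> t then \<psi> t else 0) \<in> borel_measurable borel"
proof -
  have le: "closed {t. 0 \<le> t \<and> \<psi> t \<le> ereal r}" for r
  proof -
    have "closed ((\<lambda>t. (t, r)) -` {(t, r :: real). 0 \<le> t \<and> \<psi> t \<le> ereal r})"
      using assms by (intro closed_vimage continuous_intros) (auto simp: closed_convex_fun_def)
    then show ?thesis by (simp add: vimage_def)
  qed
  have "{t. (if 0 \<le> t then \<psi> t else 0) \<le> a} \<in> sets borel" for a
  proof (cases a)
    case (real r)
    have "{t. (if 0 \<le> t then \<psi> t else 0) \<le> a} =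
        {t. 0 \<le> t \<and> \<psi> t \<le> ereal r} \<union> (if 0 \<le> r then {..<0} else {})"
      using real by (auto split: if_splits)
    then show ?thesis using le[of r] by (auto intro: borel_closed)
  next
    case MInf
    then have "{t. (if 0 \<le> t then \<psi> t else 0) \<le> a} = {}"
      using assms by (auto simp: closed_convex_fun_def)
    then show ?thesis by simp
  qed simp
  then show ?thesis
    by (auto simp: borel_measurable_iff_Iic_ereal vimage_def)
qed

lemma integrable_robust_loss:
  assumes P0: "prob_space P0"
    and l_range: "\<And>s. s \<in> space P0 \<Longrightarrow> l x s \<in> {0..B}"
    and l_measurable: "l x \<in> borel_measurable P0"
    and \<phi>: "\<phi> 1 = 0" and \<psi>: "closed_convex_fun \<psi>" "\<psi> 1 = 0"
    and nonneg: "0 \<le> \<rho>" "0 \<le> lam"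
    and qs: "measurable_maximizer X P0 l \<phi> \<psi> \<rho> lam qs"
    and k: "0 < k" and x: "x \<in> X"
  shows "integrable (PiM {..<k} (\<lambda>_. P0))
    (\<lambda>s. real_of_ereal (robust_loss l \<phi> \<psi> \<rho> lam k x s))"
proof -
  let ?P = "PiM {..<k} (\<lambda>_. P0)"
  interpret P: prob_space ?P using P0 by (intro prob_space_PiM) auto
  have q: "\<And>s. s \<in> space ?P \<Longrightarrow> qs k x s \<in> feasible_weights \<phi> \<rho> k"
      "\<And>s. s \<in> space ?P \<Longrightarrow>
        weighted_objective l \<psi> lam k x s (qs k x s) = robust_loss l \<phi> \<psi> \<rho> lam k x s"
      "\<And>i. i < k \<Longrightarrow> (\<lambda>s. qs k x s i) \<in> borel_measurable ?P"
    using qs k x by (auto simp: measurable_maximizer_def)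
  have coord: "(\<lambda>s. s i) \<in> measurable ?P P0" if "i < k" for i
    using that by (intro measurable_component_singleton) simp
  \<comment> \<open>The arguments \<open>k * q i\<close> are nonnegative, so \<open>\<psi>\<close> may be replaced by its Borel version.\<close>
  define \<psi>' where "\<psi>' t = (if 0 \<le> t then \<psi> t else 0)" for t
  have \<psi>'[measurable]: "\<psi>' \<in> borel_measurable borel"
    unfolding \<psi>'_def using borel_measurable_closed_convex_fun[OF \<psi>(1)] .
  have "(\<lambda>s. weighted_objective l \<psi>' lam k x s (qs k x s)) \<in> borel_measurable ?P"
    unfolding weighted_objective_def
    using q(3) l_measurable coord
    by (intro borel_measurable_ereal_diff borel_measurable_ereal borel_measurable_ereal_times
          borel_measurable_sum borel_measurable_ereal_sum borel_measurable_times
          measurable_compose[OF _ \<psi>'] measurable_compose[OF _ l_measurable]) auto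
  moreover have "weighted_objective l \<psi>' lam k x s (qs k x s) = robust_loss l \<phi> \<psi> \<rho> lam k x s"
    if "s \<in> space ?P" for s
    unfolding q(2)[OF that, symmetric] weighted_objective_def
    using q(1)[OF that]
    by (intro arg_cong2[where f = minus] arg_cong2[where f = times] sum.cong refl)
       (auto simp: \<psi>'_def feasible_weights_def weight_simplex_def)
  ultimately have "(\<lambda>s. robust_loss l \<phi> \<psi> \<rho> lam k x s) \<in> borel_measurable ?P"
    by (subst measurable_cong[symmetric]) auto
  then have meas: "(\<lambda>s. real_of_ereal (robust_loss l \<phi> \<psi> \<rho> lam k x s)) \<in> borel_measurable ?P"
    by measurable
  show ?thesis
  proof (rule P.integrable_const_bound[OF _ meas])
    show "AE s in ?P. norm (real_of_ereal (robust_loss l \<phi> \<psi> \<rho> lam k x s)) \<le> B"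
    proof (rule AE_I2)
      fix s assume s: "s \<in> space ?P"
      have "l x (s i) \<in> {0..B}" if "i < k" for i
        using coord[OF that] s by (intro l_range) (auto dest: measurable_space)
      from robust_loss_bounds[where l = l and \<phi> = \<phi> and x = x and s = s, OF k \<phi> \<psi> nonneg this]
      show "norm (real_of_ereal (robust_loss l \<phi> \<psi> \<rho> lam k x s)) \<le> B"
        by (cases "robust_loss l \<phi> \<psi> \<rho> lam k x s") auto
    qed
  qed
qed

text \<open>
  Each summand is dominated by the subgradient of the loss at one sample point, as the weights
  lie in $[0,1]$.
\<close>

lemma integrable_robust_grad:
  fixes gl :: "'a \<Rightarrow> 's \<Rightarrow> 'a :: {banach, second_countable_topology}"
  assumes P0: "prob_space P0" and gl: "integrable P0 (gl x)"
    and qs: "measurable_maximizer X P0 l \<phi> \<psi> \<rho> lam qs"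
    and k: "0 < k" and x: "x \<in> X"
  shows "integrable (PiM {..<k} (\<lambda>_. P0)) (robust_grad gl qs k x)"
  unfolding robust_grad_def
proof (rule Bochner_Integration.integrable_sum)
  let ?P = "PiM {..<k} (\<lambda>_. P0)"
  fix i assume "i \<in> {..<k}"
  then have i: "i < k" by simp
  have coord: "(\<lambda>s. s i) \<in> measurable ?P P0"
    using i by (intro measurable_component_singleton) simp
  have "integrable (distr ?P P0 (\<lambda>s. s i)) (gl x)"
    using distr_PiM_component[of "{..<k}" "\<lambda>_. P0" i] P0 i gl by simp
  then have int: "integrable ?P (\<lambda>s. gl x (s i))"
    using integrable_distr[OF coord] by blast
  have qm: "(\<lambda>s. qs k x s i) \<in> borel_measurable ?P"
    using qs k x i by (auto simp: measurable_maximizer_def)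
  have q1: "\<bar>qs k x s i\<bar> \<le> 1" if "s \<in> space ?P" for s
  proof -
    have "qs k x s \<in> weight_simplex k"
      using qs k x that by (auto simp: measurable_maximizer_def feasible_weights_def)
    then have "\<And>j. j < k \<Longrightarrow> 0 \<le> qs k x s j" "(\<Sum>j<k. qs k x s j) = 1"
      by (auto simp: weight_simplex_def)
    then show ?thesis
      using member_le_sum[of i "{..<k}" "qs k x s"] i by auto
  qed
  show "integrable ?P (\<lambda>s. qs k x s i *\<^sub>R gl x (s i))"
  proof (rule Bochner_Integration.integrable_bound[OF int])
    show "(\<lambda>s. qs k x s i *\<^sub>R gl x (s i)) \<in> borel_measurable ?P"
      using qm int by (intro borel_measurable_scaleR) auto
    show "AE s in ?P. norm (qs k x s i *\<^sub>R gl x (s i)) \<le> norm (gl x (s i))"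
      using q1 by (intro AE_I2) (simp add: mult_left_le_one_le)
  qed
qed

lemma surrogate_subgradient:
  fixes gl :: "'a :: euclidean_space \<Rightarrow> 's \<Rightarrow> 'a"
  assumes P0: "prob_space P0"
    and l_range: "\<And>y s. y \<in> X \<Longrightarrow> s \<in> space P0 \<Longrightarrow> l y s \<in> {0..B}"
    and l_measurable: "\<And>y. y \<in> X \<Longrightarrow> l y \<in> borel_measurable P0"
    and sub: "\<And>s. s \<in> space P0 \<Longrightarrow> is_subgradient_on X (\<lambda>z. l z s) x (gl x s)"
    and gl: "integrable P0 (gl x)"
    and \<phi>: "\<phi> 1 = 0" and \<psi>: "closed_convex_fun \<psi>" "\<psi> 1 = 0"
    and nonneg: "0 \<le> \<rho>" "0 \<le> lam"
    and qs: "measurable_maximizer X P0 l \<phi> \<psi> \<rho> lam qs"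
    and k: "0 < k" and x: "x \<in> X"
  shows "is_subgradient_on X (surrogate P0 l \<phi> \<psi> \<rho> lam k) x (surrogate_grad P0 gl qs k x)"
  unfolding is_subgradient_on_def
proof
  fix y assume y: "y \<in> X"
  let ?P = "PiM {..<k} (\<lambda>_. P0)"
  let ?L = "\<lambda>z s. real_of_ereal (robust_loss l \<phi> \<psi> \<rho> lam k z s)"
  have L: "integrable ?P (?L z)" if "z \<in> X" for z
    using integrable_robust_loss[where l = l, OF P0 l_range[OF that] l_measurable[OF that] \<phi> \<psi> nonneg qs k that] .
  have g: "integrable ?P (robust_grad gl qs k x)"
    by (rule integrable_robust_grad[where gl = gl, OF P0 gl qs k x])
  have "surrogate P0 l \<phi> \<psi> \<rho> lam k x + surrogate_grad P0 gl qs k x \<bullet> (y - x)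
      = (\<integral>s. ?L x s + robust_grad gl qs k x s \<bullet> (y - x) \<partial>?P)"
    using L[OF x] g by (simp add: surrogate_def surrogate_grad_def)
  also have "\<dots> \<le> (\<integral>s. ?L y s \<partial>?P)"
  proof (rule integral_mono)
    show "integrable ?P (\<lambda>s. ?L x s + robust_grad gl qs k x s \<bullet> (y - x))"
      using L[OF x] g by simp
    show "integrable ?P (?L y)" by (rule L[OF y])
    fix s assume s: "s \<in> space ?P"
    then have si: "s i \<in> space P0" if "i < k" for i
      using that by (auto simp: space_PiM)
    have "is_subgradient_on X (\<lambda>z. ?L z s) x (robust_grad gl qs k x s)"
      using qs k x s
      by (intro robust_loss_subgradient[where B = B] \<phi> \<psi> nonneg l_range sub si)
         (auto simp: measurable_maximizer_def)
    then show "?L x s + robust_grad gl qs k x s \<bullet> (y - x) \<le> ?L y s"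
      using y by (simp add: is_subgradient_on_def)
  qed
  finally show "surrogate P0 l \<phi> \<psi> \<rho> lam k x + surrogate_grad P0 gl qs k x \<bullet> (y - x)
      \<le> surrogate P0 l \<phi> \<psi> \<rho> lam k y"
    by (simp add: surrogate_def)
qed

section \<open>The multi-level estimator\<close>

lemma level_prob_pos: "0 < level_prob jmax j"
  by (simp add: level_prob_def)

text \<open>
  Each level below the top contributes $2^{-j} 2^j = 1$, while the top level, which carries the
  whole remaining geometric tail, contributes $2$.
\<close>

lemma sum_level_prob_weighted:
  assumes "1 \<le> jmax"
  shows "(\<Sum>j\<in>{1..jmax}. level_prob jmax j * 2 ^ j) = real jmax + 1"
proof -
  have "{1..jmax} = insert jmax {1..<jmax}" using assms by auto
  moreover have "(\<Sum>j\<in>{1..<jmax}. level_prob jmax j * 2 ^ j) = (\<Sum>j\<in>{1..<jmax}. 1)"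
    by (intro sum.cong) (auto simp: level_prob_def power_int_minus)
  moreover have "level_prob jmax jmax * 2 ^ jmax = 2"
    by (simp add: level_prob_def power_int_diff)
  ultimately show ?thesis using assms by (simp add: of_nat_diff)
qed

lemma sum_level_prob:
  assumes "1 \<le> jmax"
  shows "(\<Sum>j\<in>{1..jmax}. level_prob jmax j) = 1"
proof -
  \<comment> \<open>The levels below the top leave exactly the mass of the top level.\<close>
  have "(\<Sum>j\<in>{1..<m}. (2::real) powi (- int j)) = 1 - 2 powi (- int m + 1)" if "1 \<le> m" for m
    using that
    by (induction m rule: dec_induct) (auto simp: power_int_add power_int_minus power_int_diff divide_inverse)
  note this[OF assms]
  moreover have "{1..jmax} = insert jmax {1..<jmax}" using assms by auto
  ultimately show ?thesis by (simp add: level_prob_def)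
qed

lemma expectation_mlmc_given_level:
  fixes gl :: "'a \<Rightarrow> 's \<Rightarrow> 'a :: {banach, second_countable_topology}"
  assumes M: "prob_space M" and P0: "prob_space P0"
    and iid: "iid_sample M P0 (2 ^ j * n0) S"
    and int: "\<And>k. 0 < k \<Longrightarrow> integrable (PiM {..<k} (\<lambda>_. P0)) (robust_grad gl qs k x)"
    and n0: "0 < n0" and j: "1 \<le> j"
  shows "has_bochner_integral M (\<lambda>\<omega>. mlmc_estimator gl qs n0 jmax x j (\<lambda>i. S i \<omega>))
    (surrogate_grad P0 gl qs n0 x + (1 / level_prob jmax j) *\<^sub>R
      (surrogate_grad P0 gl qs (2 ^ j * n0) x - surrogate_grad P0 gl qs (2 ^ (j - 1) * n0) x))"
proof -
  define K where "K = 2 ^ j * n0"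
  define h where "h = 2 ^ (j - 1) * n0"
  have K: "K = h + h" using j by (cases j) (auto simp: K_def h_def)
  have h: "0 < h" using n0 by (simp add: h_def)
  have n0h: "n0 \<le> K" by (simp add: K_def)
  have *: "has_bochner_integral M (\<lambda>\<omega>. robust_grad gl qs k x (block (\<lambda>i. S i \<omega>) a k))
      (surrogate_grad P0 gl qs k x)" if "0 < k" "a + k \<le> K" for a k
    unfolding surrogate_grad_def
    by (rule expectation_block[OF M P0 iid[folded K_def] that(2) _ int[OF that(1)]])
       (use that in simp)
  \<comment> \<open>The two half blocks have the same mean, so averaging them leaves it unchanged.\<close>
  have "has_bochner_integral M (\<lambda>\<omega>. mlmc_estimator gl qs n0 jmax x j (\<lambda>i. S i \<omega>))
    (surrogate_grad P0 gl qs n0 x + (1 / level_prob jmax j) *\<^sub>R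
      (surrogate_grad P0 gl qs K x - (1/2) *\<^sub>R (surrogate_grad P0 gl qs h x + surrogate_grad P0 gl qs h x)))"
    unfolding mlmc_estimator_def level_difference_def K_def[symmetric]
    using K h n0 n0h
    by (intro has_bochner_integral_add has_bochner_integral_scaleR_right has_bochner_integral_diff)
       (auto intro!: *)
  then show ?thesis
    by (simp add: K_def h_def flip: scaleR_2)
qed

theorem claim2:
  fixes X :: "(real ^ 'd) set"
    and P0 :: "'s measure"
    and l :: "real ^ 'd \<Rightarrow> 's \<Rightarrow> real"
    and gl :: "real ^ 'd \<Rightarrow> 's \<Rightarrow> real ^ 'd"
    and B G \<rho> lam :: real
    and \<phi> \<psi> :: "real \<Rightarrow> ereal"
    and qs :: "nat \<Rightarrow> real ^ 'd \<Rightarrow> (nat \<Rightarrow> 's) \<Rightarrow> nat \<Rightarrow> real"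
    and n0 jmax n :: nat
    and x :: "real ^ 'd"
    and M :: "'w measure" and J :: "'w \<Rightarrow> nat" and S :: "nat \<Rightarrow> 'w \<Rightarrow> 's"
    and N :: "'v measure" and T :: "nat \<Rightarrow> 'v \<Rightarrow> 's"
  assumes X: "closed X" "convex X" "bounded X"
    and P0: "prob_space P0"
    and l_range: "\<And>y s. y \<in> X \<Longrightarrow> s \<in> space P0 \<Longrightarrow> l y s \<in> {0..B}"
    and l_convex: "\<And>s. s \<in> space P0 \<Longrightarrow> convex_on X (\<lambda>y. l y s)"
    and l_lipschitz: "\<And>s. s \<in> space P0 \<Longrightarrow> G-lipschitz_on X (\<lambda>y. l y s)"
    and l_measurable: "\<And>y. y \<in> X \<Longrightarrow> l y \<in> borel_measurable P0"
    and gl_subgradient: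
      "\<And>y s. y \<in> X \<Longrightarrow> s \<in> space P0 \<Longrightarrow> is_subgradient_on X (\<lambda>z. l z s) y (gl y s)"
    and gl_integrable: "\<And>y. y \<in> X \<Longrightarrow> integrable P0 (gl y)"
    and \<phi>: "closed_convex_fun \<phi>" "\<phi> 1 = 0"
    and \<psi>: "closed_convex_fun \<psi>" "\<psi> 1 = 0"
    and nonneg: "0 \<le> \<rho>" "0 \<le> lam"
    and qs: "measurable_maximizer X P0 l \<phi> \<psi> \<rho> lam qs"
    and n: "1 \<le> n0" "1 \<le> jmax" "n = 2 ^ jmax * n0"
    and x: "x \<in> X"
    and M: "prob_space M"
    and J: "J \<in> measurable M (count_space {1..jmax})"
    and J_law: "\<And>j. j \<in> {1..jmax} \<Longrightarrow>
        measure M {\<omega> \<in> space M. J \<omega> = j} = level_prob jmax j"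
    and S_given_J: "\<And>j. j \<in> {1..jmax} \<Longrightarrow>
        iid_sample (uniform_measure M {\<omega> \<in> space M. J \<omega> = j}) P0 (2 ^ j * n0) S"
    and N: "prob_space N"
    and T: "iid_sample N P0 n T"
  shows
    "integrable M (\<lambda>\<omega>. mlmc_estimator gl qs n0 jmax x (J \<omega>) (\<lambda>i. S i \<omega>)) \<and>
     integrable N (\<lambda>\<omega>. robust_grad gl qs n x (block (\<lambda>i. T i \<omega>) 0 n)) \<and>
     (\<integral>\<omega>. mlmc_estimator gl qs n0 jmax x (J \<omega>) (\<lambda>i. S i \<omega>) \<partial>M)
       = (\<integral>\<omega>. robust_grad gl qs n x (block (\<lambda>i. T i \<omega>) 0 n) \<partial>N) \<and>
     (\<integral>\<omega>. robust_grad gl qs n x (block (\<lambda>i. T i \<omega>) 0 n) \<partial>N)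
       = surrogate_grad P0 gl qs n x \<and>
     is_subgradient_on X (surrogate P0 l \<phi> \<psi> \<rho> lam n) x (surrogate_grad P0 gl qs n x) \<and>
     (\<integral>\<omega>. real (2 ^ J \<omega> * n0) \<partial>M) = real n0 * (1 + log 2 (real n / real n0))"
proof -
  define g where "g k = surrogate_grad P0 gl qs k x" for k
  have n0: "0 < n0" and npos: "0 < n" using n by auto
  have int: "integrable (PiM {..<k} (\<lambda>_. P0)) (robust_grad gl qs k x)" if "0 < k" for k
    by (rule integrable_robust_grad[where gl = gl, OF P0 gl_integrable[OF x] qs that x])
  have target: "has_bochner_integral N (\<lambda>\<omega>. robust_grad gl qs n x (block (\<lambda>i. T i \<omega>) 0 n)) (g n)"
    unfolding g_def surrogate_grad_def
    by (rule expectation_block[OF N P0 T _ npos int[OF npos]]) simp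
  interpret M: prob_space M by (rule M)
  let ?U = "\<lambda>j. uniform_measure M {\<omega> \<in> space M. J \<omega> = j}"
  let ?d = "\<lambda>j. g (2 ^ j * n0) - g (2 ^ (j - 1) * n0)"
  have pos: "0 < measure M {\<omega> \<in> space M. J \<omega> = j}" if "j \<in> {1..jmax}" for j
    using J_law[OF that] level_prob_pos by simp
  have U: "prob_space (?U j)" if "j \<in> {1..jmax}" for j
    using pos[OF that] by (intro prob_space_uniform_measure) (auto simp: measure_def)
  have "has_bochner_integral M (\<lambda>\<omega>. mlmc_estimator gl qs n0 jmax x (J \<omega>) (\<lambda>i. S i \<omega>))
      (\<Sum>j\<in>{1..jmax}. measure M {\<omega> \<in> space M. J \<omega> = j} *\<^sub>R
        (g n0 + (1 / level_prob jmax j) *\<^sub>R ?d j))"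
    using U S_given_J int n0 pos unfolding g_def
    by (intro total_expectation[OF J] expectation_mlmc_given_level[where ?P0.0 = P0]) (auto intro: P0)
  also have "(\<Sum>j\<in>{1..jmax}. measure M {\<omega> \<in> space M. J \<omega> = j} *\<^sub>R
        (g n0 + (1 / level_prob jmax j) *\<^sub>R ?d j))
      = (\<Sum>j\<in>{1..jmax}. level_prob jmax j *\<^sub>R g n0 + ?d j)"
  proof (intro sum.cong refl)
    fix j assume j: "j \<in> {1..jmax}"
    show "measure M {\<omega> \<in> space M. J \<omega> = j} *\<^sub>R (g n0 + (1 / level_prob jmax j) *\<^sub>R ?d j)
        = level_prob jmax j *\<^sub>R g n0 + ?d j"
      using J_law[OF j] level_prob_pos[of jmax j] by (simp add: scaleR_add_right)
  qed
  also have "\<dots> = g n0 + (\<Sum>j\<in>{1..jmax}. ?d j)"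
    using sum_level_prob[OF n(2)] by (simp add: sum.distrib flip: scaleR_sum_left)
  also have "(\<Sum>j\<in>{1..jmax}. ?d j) = g n - g n0"
    using sum_telescope''[of 0 jmax "\<lambda>j. g (2 ^ j * n0)"] n(3) by simp
  finally have est:
    "has_bochner_integral M (\<lambda>\<omega>. mlmc_estimator gl qs n0 jmax x (J \<omega>) (\<lambda>i. S i \<omega>)) (g n)"
    by simp
  have "has_bochner_integral M (\<lambda>\<omega>. real (2 ^ J \<omega> * n0))
      (\<Sum>j\<in>{1..jmax}. measure M {\<omega> \<in> space M. J \<omega> = j} *\<^sub>R real (2 ^ j * n0))"
  proof (rule total_expectation[OF J _ pos])
    fix j assume "j \<in> {1..jmax}"
    then interpret U: prob_space "?U j" by (rule U)
    show "has_bochner_integral (?U j) (\<lambda>\<omega>. real (2 ^ j * n0)) (real (2 ^ j * n0))"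
      using U.prob_space by (simp add: has_bochner_integral_iff)
  qed auto
  also have "(\<Sum>j\<in>{1..jmax}. measure M {\<omega> \<in> space M. J \<omega> = j} *\<^sub>R real (2 ^ j * n0))
      = real n0 * (\<Sum>j\<in>{1..jmax}. level_prob jmax j * 2 ^ j)"
    unfolding sum_distrib_left using J_law by (intro sum.cong) auto
  also have "\<dots> = real n0 * (1 + log 2 (real n / real n0))"
    using n0 n(3) sum_level_prob_weighted[OF n(2)] by (simp add: log_nat_power)
  finally have size:
    "has_bochner_integral M (\<lambda>\<omega>. real (2 ^ J \<omega> * n0)) (real n0 * (1 + log 2 (real n / real n0)))" .
  have "is_subgradient_on X (surrogate P0 l \<phi> \<psi> \<rho> lam n) x (surrogate_grad P0 gl qs n x)"
    using l_range l_measurable gl_subgradient gl_integrable x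
    by (intro surrogate_subgradient[OF P0 _ _ _ _ \<phi>(2) \<psi> nonneg qs npos x]) auto
  with est target size show ?thesis
    unfolding g_def by (auto simp: has_bochner_integral_iff)
qed

end
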